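(* The subshift $X$ generated by the $\tfrac{3}{2}$-Thue--Morse word has additive eigenvalue group $$E(X,S) = \big\{ \tfrac{k}{3^n} : k\in\mathbb Z,\ n \ge 0 \big\}.$$
   Context: The $\tfrac32$-Thue--Morse word $\mathbf t=\mathbf t_0\mathbf t_1\mathbf t_2\cdots\in\{0,1\}^{\mathbb N}$ is defined by letting $\mathbf t_n$ be the sum modulo $2$ of the digits of the expansion of $n$ in base $\tfrac32$, where the digits $d_0,d_1,\dots\in\{0,1,2\}$ of $n$ are given by $N_0=n$, $2N_i=3N_{i+1}+d_i$ with $N_i\in\mathbb N$ (so $n=\sum_i \frac{d_i}{2}(\frac32)^i$). Equivalently (a known characterization), $\mathbf t$ is the unique infinite word beginning with $0$ with $\mathbf t=\sigma(0,\mathbf t_0)\,\sigma(1,\mathbf t_1)\,\sigma(0,\mathbf t_2)\,\sigma(1,\mathbf t_3)\cdots$, where $\sigma(0,0)=00$, $\sigma(0,1)=11$, $\sigma(1,0)=1$, $\sigma(1,1)=0$. The subshift $X\subseteq\{0,1\}^{\mathbb Z}$ generated by $\mathbf t$ is the set of bi-infinite sequences all of whose finite factors occur in $\mathbf t$; $S$ is the shift map. $E(X,S)$ is the group of continuous additive eigenvalues of $X$: real $\alpha$ for which there is a continuous $g:X\to\mathbb R/\mathbb Z$ with $g(Sx)=g(x)+\alpha\pmod{\mathbb Z}$ for all $x\in X$. *)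

theory Defs
  imports "HOL-Analysis.Analysis"
begin

section \<open>The $\frac32$-Thue--Morse word\<close>

text \<open>Since the digits lie in \<open>{0,1,2}\<close>, the relation \<open>2 N\<^sub>i = 3 N\<^sub>i\<^sub>+\<^sub>1 + d\<^sub>i\<close> is division
  with remainder of \<open>2 N\<^sub>i\<close> by \<open>3\<close>.\<close>

primrec base32_quot :: "nat \<Rightarrow> nat \<Rightarrow> nat" where
  "base32_quot n 0 = n"
| "base32_quot n (Suc i) = 2 * base32_quot n i div 3"

definition base32_digit :: "nat \<Rightarrow> nat \<Rightarrow> nat" where
  "base32_digit n i = 2 * base32_quot n i mod 3"

lemma base32_step: "2 * base32_quot n i = 3 * base32_quot n (Suc i) + base32_digit n i"
  by (simp add: base32_digit_def)

lemma base32_digit_less: "base32_digit n i < 3"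
  by (simp add: base32_digit_def)

lemma base32_quot_le: "base32_quot n i \<le> n - i"
proof (induction i)
  case (Suc i)
  have "2 * q div 3 \<le> q - 1" for q :: nat
    by presburger
  from this[of "base32_quot n i"] Suc show ?case
    by simp
qed simp

text \<open>The set over which the word below sums the digits is finite, so the sum is not
  the default value \<open>0\<close> of a sum over an infinite set.\<close>

lemma finite_base32_digits: "finite {i. base32_digit n i \<noteq> 0}"
proof (rule finite_subset)
  show "{i. base32_digit n i \<noteq> 0} \<subseteq> {..<n}"
  proof
    fix i assume "i \<in> {i. base32_digit n i \<noteq> 0}"
    then have "base32_quot n i \<noteq> 0"
      by (auto simp: base32_digit_def)
    with base32_quot_le[of n i] show "i \<in> {..<n}"
      by simp
  qed
qed simp

definition thue_morse32 :: "nat \<Rightarrow> nat" where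
  "thue_morse32 n = (\<Sum>i | base32_digit n i \<noteq> 0. base32_digit n i) mod 2"


section \<open>Subshifts\<close>

text \<open>Bi-infinite words carry the product topology of the discrete topology on \<^typ>\<open>nat\<close>.
  The subshift of a word over \<open>{0,1}\<close> consists of words over \<open>{0,1}\<close>, and the subspace topology
  on it is the one inherited from \<open>{0,1}\<^sup>\<int>\<close>.\<close>

definition shift :: "(int \<Rightarrow> 'a) \<Rightarrow> (int \<Rightarrow> 'a)" where
  "shift x = (\<lambda>i. x (i + 1))"

definition generated_subshift :: "(nat \<Rightarrow> 'a) \<Rightarrow> (int \<Rightarrow> 'a) set" where
  "generated_subshift w = {x. \<forall>i len. \<exists>n. \<forall>j<len. x (i + int j) = w (n + j)}"


section \<open>The topological group $\mathbb R/\mathbb Z$\<close>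

quotient_type real_mod_int = real / "\<lambda>x y. x - y \<in> \<int>"
  morphisms rep_mod_int mod_int
proof (rule equivpI)
  show "reflp (\<lambda>x y :: real. x - y \<in> \<int>)"
    by (simp add: reflp_def)
  show "symp (\<lambda>x y :: real. x - y \<in> \<int>)"
    unfolding symp_def by (metis Ints_minus minus_diff_eq)
  show "transp (\<lambda>x y :: real. x - y \<in> \<int>)"
    unfolding transp_def by (metis Ints_add diff_add_cancel add_diff_eq)
qed

instantiation real_mod_int :: ab_group_add
begin

lift_definition zero_real_mod_int :: real_mod_int is 0 .

lift_definition plus_real_mod_int :: "real_mod_int \<Rightarrow> real_mod_int \<Rightarrow> real_mod_int" is "(+)"
  by (metis Ints_add add_diff_add)

lift_definition uminus_real_mod_int :: "real_mod_int \<Rightarrow> real_mod_int" is uminus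
  by (metis Ints_minus minus_diff_minus)

lift_definition minus_real_mod_int :: "real_mod_int \<Rightarrow> real_mod_int \<Rightarrow> real_mod_int" is "(-)"
  by (metis Ints_diff diff_diff_eq2 diff_diff_add add_diff_eq add.commute diff_add_eq)

instance
  by standard (transfer; simp)+

end

text \<open>The quotient topology.\<close>

instantiation real_mod_int :: topological_space
begin

definition open_real_mod_int :: "real_mod_int set \<Rightarrow> bool" where
  "open_real_mod_int U \<longleftrightarrow> open (mod_int -` U)"

instance
proof
  show "open (UNIV :: real_mod_int set)"
    by (simp add: open_real_mod_int_def)
  show "open (U \<inter> V)" if "open U" "open V" for U V :: "real_mod_int set"
    using that by (simp add: open_real_mod_int_def vimage_Int open_Int)
  show "open (\<Union>K)" if "\<forall>U\<in>K. open U" for K :: "real_mod_int set set"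
    using that by (auto simp: open_real_mod_int_def vimage_Union)
qed

end


section \<open>Continuous additive eigenvalues\<close>

definition additive_eigenvalues :: "'a::topological_space set \<Rightarrow> ('a \<Rightarrow> 'a) \<Rightarrow> real set" where
  "additive_eigenvalues X S =
     {\<alpha>. \<exists>g :: 'a \<Rightarrow> real_mod_int.
        continuous_on X g \<and> (\<forall>x\<in>X. g (S x) = g x + mod_int \<alpha>)}"

end

theory Submission
  imports Defs "HOL-Number_Theory.Cong"
begin

text \<open>Write \<open>t\<close> for the word \<^const>\<open>thue_morse32\<close> and \<open>X\<close> for its subshift. Everything rests on
  the self-similarity \<open>t (3m + i) = (2i mod 3) + t (2m + \<lfloor>2i/3\<rfloor>)\<close> modulo \<open>2\<close>
  (\<open>thue_morse32_block\<close>): whether \<open>t\<close> takes the same value at two positions \<open>3a + i\<close> and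
  \<open>3b + i\<close> is decided at \<open>2a + \<lfloor>2i/3\<rfloor>\<close> and \<open>2b + \<lfloor>2i/3\<rfloor>\<close>. This fact is used in both directions.

  \<^bold>\<open>Every \<open>k/3\<^sup>n\<close> is an eigenvalue.\<close> The word is recognizable: a sufficiently long window
  determines its position modulo \<open>3\<^sup>n\<close> (\<open>thue_morse32_recognizable\<close>). For \<open>n = 1\<close> this holds because
  \<open>t\<close> never changes its value from \<open>3k\<close> to \<open>3k + 1\<close>, but regularly does so after positions of the two
  other classes. For larger \<open>n\<close>, equal windows at \<open>3k\<close> and \<open>3l\<close> give equal windows at \<open>2k\<close> and
  \<open>2l\<close>, so that \<open>k\<close> and \<open>l\<close> agree modulo \<open>3\<^sup>n\<^sup>-\<^sup>1\<close> by induction, \<open>2\<close> being invertible. Reading the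
  position \<open>p\<close> modulo \<open>3\<^sup>n\<close> off a window of a point of \<open>X\<close> gives the locally constant eigenfunction
  \<open>kp/3\<^sup>n\<close> (\<open>triadic_in_eigenvalues\<close>).

  \<^bold>\<open>There are no others.\<close> The self-similarity carries a window at \<open>2a\<close> to a longer one at
  \<open>3a\<close>, and this can be repeated \<open>n\<close> times from a multiple of \<open>2\<^sup>n\<close>. So if \<open>t\<close> takes the same value at \<open>2\<^sup>na\<close>
  and \<open>2\<^sup>nb\<close>, then the windows of length \<open>n + 1\<close> at \<open>3\<^sup>na\<close> and \<open>3\<^sup>nb\<close> coincide
  (\<open>thue_morse32_pow_windows\<close>). The choice \<open>a = 2\<close>, \<open>b = 3\<close> is always possible, so \<open>3\<^sup>n\<close> is a
  return time to a window of length \<open>n + 1\<close> (\<open>thue_morse32_return\<close>). A continuous eigenfunction is uniformly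
  continuous, hence \<open>3\<^sup>n\<alpha> \<rightarrow> 0\<close> modulo \<open>1\<close> for every eigenvalue \<open>\<alpha>\<close> (\<open>eigenvalue_powers_tendsto\<close>). Since
  multiplication by \<open>3\<close> repels from \<open>0\<close>, the sequence must reach \<open>0\<close>
  (\<open>cubing_repels_from_1\<close>, where \<open>3x\<close> has become the cube of \<open>exp (2\<pi>ix)\<close>), that is, \<open>3\<^sup>n\<alpha>\<close> is an integer for some \<open>n\<close>.

  The return is a fact about the one-sided word and has to be found in a point of \<open>X\<close>. A prefix of \<open>t\<close>
  occurs in \<open>X\<close> if it recurs in \<open>t\<close>, but it suffices that it or its complement recurs, which
  \<open>thue_morse32_pow_windows\<close> yields without further study of the word
  (\<open>subshift_contains_equality_pattern\<close>).\<close>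


section \<open>Self-similarity of the word\<close>

lemma base32_quot_Suc: "base32_quot n (Suc i) = base32_quot (2 * n div 3) i"
  by (induction i) simp_all

lemma thue_morse32_eq_sum:
  assumes "n \<le> K"
  shows "thue_morse32 n = (\<Sum>i<K. base32_digit n i) mod 2"
proof -
  have "i < K" if "base32_digit n i \<noteq> 0" for i
  proof -
    have "base32_quot n i \<noteq> 0"
      using that by (auto simp: base32_digit_def)
    with base32_quot_le[of n i] assms show ?thesis
      by simp
  qed
  then have "(\<Sum>i | base32_digit n i \<noteq> 0. base32_digit n i) = (\<Sum>i<K. base32_digit n i)"
    by (intro sum.mono_neutral_left) auto
  then show ?thesis
    by (simp add: thue_morse32_def)
qed

lemma thue_morse32_rec: "thue_morse32 n = (2 * n mod 3 + thue_morse32 (2 * n div 3)) mod 2"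
proof -
  have "base32_digit n (Suc i) = base32_digit (2 * n div 3) i" for i
    by (simp only: base32_digit_def base32_quot_Suc)
  then have "thue_morse32 n = (base32_digit n 0 + (\<Sum>i<n. base32_digit (2 * n div 3) i)) mod 2"
    by (subst thue_morse32_eq_sum[of n "Suc n"])
       (simp_all add: sum.lessThan_Suc_shift del: sum.lessThan_Suc)
  moreover have "thue_morse32 (2 * n div 3) = (\<Sum>i<n. base32_digit (2 * n div 3) i) mod 2"
    by (rule thue_morse32_eq_sum) simp
  ultimately show ?thesis
    by (simp add: base32_digit_def mod_add_right_eq)
qed

text \<open>The block substitution in one formula: \<open>i\<close> need not be a digit, so that whole windows,
  not only single blocks of length \<open>3\<close>, are carried from \<open>2m\<close> to \<open>3m\<close>.\<close>

lemma thue_morse32_block: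
  "thue_morse32 (3 * m + i) = (2 * i mod 3 + thue_morse32 (2 * m + 2 * i div 3)) mod 2"
proof -
  have "2 * (3 * m + i) = 2 * i + 3 * (2 * m)"
    by simp
  then have "2 * (3 * m + i) div 3 = 2 * m + 2 * i div 3" "2 * (3 * m + i) mod 3 = 2 * i mod 3"
    by presburger+
  then show ?thesis
    by (subst thue_morse32_rec) simp
qed

lemma thue_morse32_less_2: "thue_morse32 n < 2"
  by (simp add: thue_morse32_def)

lemma thue_morse32_block_eq_iff:
  "thue_morse32 (3 * a + i) = thue_morse32 (3 * b + i) \<longleftrightarrow>
   thue_morse32 (2 * a + 2 * i div 3) = thue_morse32 (2 * b + 2 * i div 3)"
proof -
  have "(d + u) mod 2 = (d + v) mod 2 \<longleftrightarrow> u = v" if "u < 2" "v < 2" for d u v :: nat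
    using that by presburger
  then show ?thesis
    by (simp add: thue_morse32_block thue_morse32_less_2)
qed

text \<open>Each step from \<open>2a\<close> to \<open>3a\<close> lengthens a common window by at least one letter, because
  \<open>\<lfloor>2i/3\<rfloor> < i\<close> for \<open>i > 0\<close>; the power of \<open>2\<close> pays for \<open>n\<close> such steps. The truth value \<open>e\<close> covers equal and
  complementary windows at once.\<close>

lemma thue_morse32_pow_windows:
  assumes "(thue_morse32 (2 ^ n * a) = thue_morse32 (2 ^ n * b)) = e" "i \<le> n"
  shows "(thue_morse32 (3 ^ n * a + i) = thue_morse32 (3 ^ n * b + i)) = e"
  using assms
proof (induction n arbitrary: a b i)
  case 0
  then show ?case by simp
next
  case (Suc n)
  have "2 * i div 3 \<le> n"
    using Suc.prems(2) by linarith
  moreover have "(thue_morse32 (2 ^ n * (2 * a)) = thue_morse32 (2 ^ n * (2 * b))) = e"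
    using Suc.prems(1) by (simp add: ac_simps)
  ultimately have "(thue_morse32 (3 ^ n * (2 * a) + 2 * i div 3)
      = thue_morse32 (3 ^ n * (2 * b) + 2 * i div 3)) = e"
    by (rule Suc.IH[rotated])
  then show ?case
    using thue_morse32_block_eq_iff[of "3 ^ n * a" i "3 ^ n * b"] by (simp add: ac_simps)
qed

text \<open>The starting values agree because \<open>t (3m) = t (2m)\<close> for \<open>m = 2\<^sup>n\<close>.\<close>

lemma thue_morse32_return:
  assumes "i \<le> n"
  shows "thue_morse32 (2 * 3 ^ n + i) = thue_morse32 (3 * 3 ^ n + i)"
proof -
  have "thue_morse32 (2 ^ n * 2) = thue_morse32 (2 ^ n * 3)"
    using thue_morse32_block[of "2 ^ n" 0] thue_morse32_less_2[of "2 ^ n * 2"]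
    by (simp add: mult.commute)
  then show ?thesis
    using thue_morse32_pow_windows[of n 2 3 True i] assms by (simp add: mult.commute)
qed


section \<open>Recognizability\<close>

lemma thue_morse32_triple:
  "thue_morse32 (3 * k) = thue_morse32 (2 * k)"
  "thue_morse32 (3 * k + 1) = thue_morse32 (2 * k)"
  "thue_morse32 (3 * k + 2) = 1 - thue_morse32 (2 * k + 1)"
  using thue_morse32_block[of k 0] thue_morse32_block[of k 1] thue_morse32_block[of k 2]
    thue_morse32_less_2[of "2 * k"] thue_morse32_less_2[of "2 * k + 1"]
  by (auto simp: less_2_cases_iff)

text \<open>Desubstituting the two letters on either side leads in both cases to a pair of positions
  \<open>3m, 3m + 1\<close>, where \<open>t\<close> is constant; exactly one of the two letters is complemented on the way.\<close>

lemma thue_morse32_neq_mod_9: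
  "thue_morse32 (9 * j + 1) \<noteq> thue_morse32 (9 * j + 2)"
  "thue_morse32 (9 * j + 5) \<noteq> thue_morse32 (9 * j + 6)"
proof -
  have "thue_morse32 (9 * j + 1) = thue_morse32 (6 * j)"
       "thue_morse32 (9 * j + 2) = 1 - thue_morse32 (6 * j + 1)"
       "thue_morse32 (6 * j) = thue_morse32 (6 * j + 1)"
       "thue_morse32 (9 * j + 5) = 1 - thue_morse32 (6 * j + 3)"
       "thue_morse32 (9 * j + 6) = thue_morse32 (6 * j + 4)"
       "thue_morse32 (6 * j + 3) = thue_morse32 (6 * j + 4)"
    using thue_morse32_triple[of "3 * j"] thue_morse32_triple[of "3 * j + 1"]
      thue_morse32_triple[of "3 * j + 2"] thue_morse32_triple[of "2 * j"]
      thue_morse32_triple[of "2 * j + 1"]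
    by (simp_all add: algebra_simps numeral_eq_Suc)
  then show "thue_morse32 (9 * j + 1) \<noteq> thue_morse32 (9 * j + 2)"
    "thue_morse32 (9 * j + 5) \<noteq> thue_morse32 (9 * j + 6)"
    using thue_morse32_less_2[of "6 * j + 1"] thue_morse32_less_2[of "6 * j + 4"]
    by (auto simp: less_2_cases_iff)
qed

text \<open>If the positions differed modulo \<open>3\<close>, every ascent or descent of \<open>t\<close> after a position \<open>q + i\<close> in
  one fixed class \<open>1\<close> or \<open>2\<close> modulo \<open>3\<close> would have to occur after a multiple \<open>p + i\<close> of \<open>3\<close>, where
  there is none. Nine consecutive positions contain one of the required class modulo \<open>9\<close>.\<close>

lemma thue_morse32_recognizable_3:
  assumes "\<And>i. i < 10 \<Longrightarrow> thue_morse32 (p + i) = thue_morse32 (q + i)"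
  shows "p mod 3 = q mod 3"
proof (rule ccontr)
  assume neq: "p mod 3 \<noteq> q mod 3"
  have no_change: False
    if "(p + i) mod 3 = 0" "i < 9" "thue_morse32 (q + i) \<noteq> thue_morse32 (q + i + 1)" for i
  proof -
    from that(1) obtain k where "p + i = 3 * k"
      by (auto simp: mod_eq_0_iff_dvd)
    then have "thue_morse32 (p + i) = thue_morse32 (p + i + 1)"
      using thue_morse32_triple[of k] by simp
    with that(2,3) assms[of i] assms[of "i + 1"] show False
      by simp
  qed
  \<comment> \<open>The class modulo \<open>9\<close> of \<open>q + i\<close> for which a change of value follows while \<open>3\<close> divides \<open>p + i\<close>.\<close>
  define s where "s = (if q mod 3 = (p + 1) mod 3 then 1 else 5 :: nat)"
  \<comment> \<open>\<open>8\<close> stands for \<open>-1\<close>: this is the offset from \<open>q\<close> to the next position of class \<open>s\<close>.\<close>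
  define i where "i = (s + 8 * q) mod 9"
  define j where "j = (q + i) div 9"
  have "(q + i) mod 9 = (9 * q + s) mod 9"
    unfolding i_def mod_add_right_eq by (simp add: algebra_simps)
  then have j: "q + i = 9 * j + s"
    using mult_div_mod_eq[of 9 "q + i"] by (simp add: j_def s_def)
  have "i < 9"
    by (simp add: i_def)
  have "(p + i) mod 3 = 0"
  proof (cases "q mod 3 = (p + 1) mod 3")
    case True
    then have "(p + 1 + i) mod 3 = (q + i) mod 3"
      by (intro mod_add_cong) simp_all
    moreover have "(q + i) mod 3 = 1"
      unfolding j s_def if_P[OF True] by presburger
    ultimately have "Suc (p + i) mod 3 = 1"
      by simp
    then show ?thesis
      by (auto simp: mod_Suc split: if_splits)
  next
    case False
    have "n mod 3 = 0 \<or> n mod 3 = 1 \<or> n mod 3 = 2" for n :: nat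
      by linarith
    from this[of p] this[of q] have "q mod 3 = Suc (Suc p) mod 3"
      using neq False by (auto simp: mod_Suc)
    then have "(Suc (Suc p) + i) mod 3 = (q + i) mod 3"
      by (intro mod_add_cong) simp_all
    moreover have "(q + i) mod 3 = 2"
      unfolding j s_def if_not_P[OF False] by presburger
    ultimately have "Suc (Suc (p + i)) mod 3 = 2"
      by simp
    then show ?thesis
      by (auto simp: mod_Suc split: if_splits)
  qed
  moreover have "thue_morse32 (q + i) \<noteq> thue_morse32 (q + i + 1)"
    unfolding j s_def using thue_morse32_neq_mod_9[of j] by (simp add: add.commute[of 6])
  ultimately show False
    by (rule no_change[OF _ \<open>i < 9\<close>])
qed

text \<open>Once the residue modulo \<open>3\<close> is known, the window can be cut at a block boundary
  and desubstituted; this costs a factor \<open>3/2\<close> of its length, of which \<open>2\<close> is a crude bound.\<close>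

lemma thue_morse32_recognizable:
  "\<exists>L. \<forall>p q. (\<forall>i<L. thue_morse32 (p + i) = thue_morse32 (q + i)) \<longrightarrow> [p = q] (mod 3 ^ n)"
proof (induction n)
  case 0
  then show ?case by simp
next
  case (Suc n)
  then obtain L where L: "[p = q] (mod 3 ^ n)"
    if "\<And>i. i < L \<Longrightarrow> thue_morse32 (p + i) = thue_morse32 (q + i)" for p q
    by blast
  have "[p = q] (mod 3 ^ Suc n)"
    if window: "\<And>i. i < 2 * L + 10 \<Longrightarrow> thue_morse32 (p + i) = thue_morse32 (q + i)" for p q
  proof -
    have mod_3: "p mod 3 = q mod 3"
      using window by (intro thue_morse32_recognizable_3) simp
    define k l r where "k = p div 3" "l = q div 3" "r = p mod 3"
    have p: "p = 3 * k + r" and q: "q = 3 * l + r" and "r < 3"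
      using mult_div_mod_eq[of 3 p] mult_div_mod_eq[of 3 q] mod_3 by (simp_all add: k_l_r_def)
    \<comment> \<open>Blocks \<open>k\<close> and \<open>l\<close> may begin before the windows; the next ones do not.\<close>
    have "thue_morse32 (2 * (k + 1) + j) = thue_morse32 (2 * (l + 1) + j)" if "j < L" for j
    proof -
      \<comment> \<open>The least \<open>i\<close> with \<open>\<lfloor>2i/3\<rfloor> = j\<close>.\<close>
      define i where "i = (3 * j + 1) div 2"
      have j: "2 * i div 3 = j" and i: "i \<le> 2 * L"
        using that unfolding i_def by linarith+
      have "p + (3 - r + i) = 3 * (k + 1) + i" "q + (3 - r + i) = 3 * (l + 1) + i"
        using p q \<open>r < 3\<close> by simp_all
      then have "thue_morse32 (3 * (k + 1) + i) = thue_morse32 (3 * (l + 1) + i)"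
        using window[of "3 - r + i"] i by (simp only:)
      then show ?thesis
        using thue_morse32_block_eq_iff[of "k + 1" i "l + 1"] j by simp
    qed
    then have "[2 * (k + 1) = 2 * (l + 1)] (mod 3 ^ n)"
      by (rule L)
    then have "[k + 1 = l + 1] (mod 3 ^ n)"
      by (subst (asm) cong_mult_lcancel_nat) simp_all
    then have "[k = l] (mod 3 ^ n)"
      by (subst (asm) cong_add_rcancel_nat)
    then have "[3 * k = 3 * l] (mod 3 * 3 ^ n)"
      unfolding cong_def by (metis mult_mod_right)
    then show ?thesis
      unfolding p q cong_add_rcancel_nat power_Suc .
  qed
  then show ?case
    by blast
qed


section \<open>Compactness of subshifts\<close>

lemma open_finite_window:
  fixes A :: "('a \<Rightarrow> 'b::discrete_topology) set"
  assumes "finite F" and "\<And>x y. x \<in> A \<Longrightarrow> \<forall>i\<in>F. y i = x i \<Longrightarrow> y \<in> A"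
  shows "open A"
proof -
  have "open {y :: 'a \<Rightarrow> 'b. y i = c}" for i c
    using open_vimage[OF open_discrete continuous_on_product_coordinates[of i], of "{c}"]
    by (simp add: vimage_def)
  then have "open (\<Inter>i\<in>F. {y. y i = x i})" for x :: "'a \<Rightarrow> 'b"
    using assms(1) by (intro open_INT) auto
  then have "open (\<Union>x\<in>A. \<Inter>i\<in>F. {y. y i = x i})"
    by (intro open_UN ballI)
  moreover have "A = (\<Union>x\<in>A. \<Inter>i\<in>F. {y. y i = x i})"
    using assms(2) by auto
  ultimately show ?thesis
    by (rule back_subst[where P = "open", OF _ sym])
qed

lemma closed_generated_subshift:
  fixes w :: "nat \<Rightarrow> 'a::discrete_topology"
  shows "closed (generated_subshift w)"
proof -
  define bad where "bad i len = {x :: int \<Rightarrow> 'a. \<not> (\<exists>n. \<forall>j<len. x (i + int j) = w (n + j))}"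
    for i len
  have "open (bad i len)" for i len
    by (rule open_finite_window[of "(\<lambda>j. i + int j) ` {..<len}"])
       (simp, simp add: bad_def, metis lessThan_iff)
  moreover have "generated_subshift w = - (\<Union>i len. bad i len)"
    unfolding generated_subshift_def bad_def by blast
  ultimately show ?thesis
    by (metis closed_def open_UN double_complement)
qed

lemma compact_words:
  assumes "finite A"
  shows "compact {x :: 'i \<Rightarrow> 'a::discrete_topology. \<forall>i. x i \<in> A}"
proof -
  have "compactin (product_topology (\<lambda>_. euclidean) UNIV) (\<Pi>\<^sub>E i\<in>(UNIV :: 'i set). A)"
    using assms by (subst compactin_PiE) (simp add: finite_imp_compact)
  moreover have "(\<Pi>\<^sub>E i\<in>(UNIV :: 'i set). A) = {x. \<forall>i. x i \<in> A}"
    by (auto simp: PiE_UNIV_domain)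
  ultimately show ?thesis
    by (simp add: euclidean_product_topology)
qed

lemma compact_generated_subshift:
  fixes w :: "nat \<Rightarrow> 'a::discrete_topology"
  assumes "finite (range w)"
  shows "compact (generated_subshift w)"
proof -
  have "x i \<in> range w" if "x \<in> generated_subshift w" for x i
  proof -
    have "\<exists>n. \<forall>j<1. x (i + int j) = w (n + j)"
      using that unfolding generated_subshift_def by blast
    then show ?thesis
      by auto
  qed
  then have "generated_subshift w = {x. \<forall>i. x i \<in> range w} \<inter> generated_subshift w"
    by auto
  then show ?thesis
    by (metis compact_Int_closed compact_words[OF assms] closed_generated_subshift)
qed

lemma shift_generated_subshift:
  assumes "x \<in> generated_subshift w"
  shows "shift x \<in> generated_subshift w"
proof -
  have "\<exists>n. \<forall>j<len. x (i + 1 + int j) = w (n + j)" for i len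
    using assms unfolding generated_subshift_def by blast
  then show ?thesis
    by (simp add: generated_subshift_def shift_def ac_simps)
qed

lemma funpow_shift: "(shift ^^ h) x i = x (i + int h)"
  by (induction h arbitrary: i) (simp_all add: shift_def ac_simps)

lemma funpow_shift_generated_subshift:
  assumes "x \<in> generated_subshift w"
  shows "(shift ^^ h) x \<in> generated_subshift w"
  using assms by (induction h) (simp_all add: shift_generated_subshift)

text \<open>Extending occurrences of \<open>u\<close> further and further to the left gives, by compactness, a
  bi-infinite word: the words that carry \<open>u\<close> at \<open>0\<close> and a factor of \<open>w\<close> around \<open>0\<close> of radius \<open>m\<close> form closed
  sets with the finite intersection property.\<close>

lemma generated_subshift_recurrent_word:
  fixes w :: "nat \<Rightarrow> 'a::discrete_topology"
  assumes "finite (range w)" and recurrent: "\<And>N. \<exists>p\<ge>N. \<forall>i<M. w (p + i) = u i"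
  shows "\<exists>x \<in> generated_subshift w. \<forall>i<M. x (int i) = u i"
proof -
  define D where "D m = {x. (\<forall>i<M. x (int i) = u i) \<and>
    (\<exists>n. \<forall>j<2 * m. x (int j - int m) = w (n + j))}" for m :: nat
  let ?K = "{x :: int \<Rightarrow> 'a. \<forall>i. x i \<in> range w}"
  have closed_D: "closed (D m)" for m
    unfolding closed_def
    by (rule open_finite_window[of "int ` {..<M} \<union> (\<lambda>j. int j - int m) ` {..<2 * m}"])
       (simp_all add: D_def)
  have fip: "?K \<inter> (\<Inter>m\<in>I. D m) \<noteq> {}" if "finite I" for I
  proof -
    obtain m where m: "\<And>k. k \<in> I \<Longrightarrow> k \<le> m"
      using \<open>finite I\<close> by (meson finite_nat_set_iff_bounded_le)
    obtain p where "p \<ge> m" and p: "\<And>i. i < M \<Longrightarrow> w (p + i) = u i"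
      using recurrent by blast
    \<comment> \<open>Left of \<open>-p\<close> the letter \<open>w 0\<close> is repeated; windows of radius at most \<open>m \<le> p\<close> do not reach it.\<close>
    define x where "x i = w (nat (int p + i))" for i
    have "x (int j - int k) = w (p - k + j)" if "k \<in> I" for k j
    proof -
      have "nat (int p + (int j - int k)) = p - k + j"
        using m[OF that] \<open>p \<ge> m\<close> by linarith
      then show ?thesis
        by (simp add: x_def)
    qed
    moreover have "x (int i) = u i" if "i < M" for i
      using p[OF that] by (simp add: x_def nat_add_distrib)
    ultimately have "x \<in> ?K \<inter> (\<Inter>m\<in>I. D m)"
      by (auto simp: D_def) (auto simp: x_def)
    then show ?thesis
      by blast
  qed
  have "?K \<inter> (\<Inter>m. D m) \<noteq> {}"
    using compact_words[OF assms(1)] closed_D fip by (rule compact_imp_fip_image)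
  then obtain x where x: "\<And>m. x \<in> D m"
    by blast
  have "\<exists>n. \<forall>j<len. x (i + int j) = w (n + j)" for i len
  proof -
    define m where "m = nat \<bar>i\<bar> + len"
    then have m: "int m = \<bar>i\<bar> + int len"
      by simp
    obtain n where n: "\<And>j. j < 2 * m \<Longrightarrow> x (int j - int m) = w (n + j)"
      using x[of m] by (auto simp: D_def)
    have "x (i + int j) = w (n + nat (i + int m) + j)" if "j < len" for j
    proof -
      have "int (nat (i + int m) + j) - int m = i + int j" "nat (i + int m) + j < 2 * m"
        using that m by linarith+
      with n[of "nat (i + int m) + j"] show ?thesis
        by (simp add: add.assoc)
    qed
    then show ?thesis
      by blast
  qed
  moreover have "\<forall>i<M. x (int i) = u i"
    using x[of 0] by (simp add: D_def)
  ultimately show ?thesis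
    unfolding generated_subshift_def by blast
qed

lemma finite_range_thue_morse32: "finite (range thue_morse32)"
  by (rule finite_subset[of _ "{..<2}"]) (auto simp: thue_morse32_less_2)

text \<open>Equalities between letters of \<open>t\<close> are insensitive to complementation. If \<open>t (2\<^sup>Ma) = 0\<close> for
  infinitely many \<open>a\<close>, the prefix of length \<open>M\<close> recurs at the positions \<open>3\<^sup>Ma\<close>; otherwise
  \<open>t (2\<^sup>Ma) = 1\<close> from some point on and its complement recurs there.\<close>

lemma subshift_contains_equality_pattern:
  "\<exists>x \<in> generated_subshift thue_morse32. \<forall>i<M. \<forall>j<M.
     thue_morse32 i = thue_morse32 j \<longrightarrow> x (int i) = x (int j)"
proof -
  define e where "e \<longleftrightarrow> (\<forall>N. \<exists>a\<ge>N. thue_morse32 (2 ^ M * a) = thue_morse32 0)"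
  define u where "u i = (if e then thue_morse32 i else 1 - thue_morse32 i)" for i
  have "\<exists>p\<ge>N. \<forall>i<M. thue_morse32 (p + i) = u i" for N
  proof -
    obtain N0 where N0: "\<not> e \<Longrightarrow> \<forall>a\<ge>N0. thue_morse32 (2 ^ M * a) \<noteq> thue_morse32 0"
      unfolding e_def by metis
    have "\<exists>a\<ge>N. (thue_morse32 (2 ^ M * a) = thue_morse32 0) = e"
    proof (cases e)
      case True
      then show ?thesis by (auto simp: e_def)
    next
      case False
      with N0 show ?thesis by (intro exI[of _ "max N N0"]) simp
    qed
    then obtain a where "a \<ge> N" and a: "(thue_morse32 (2 ^ M * a) = thue_morse32 (2 ^ M * 0)) = e"
      by auto
    have "thue_morse32 (3 ^ M * a + i) = u i" if "i < M" for i
      using thue_morse32_pow_windows[OF a, of i] that thue_morse32_less_2[of i]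
        thue_morse32_less_2[of "3 ^ M * a + i"]
      by (auto simp: u_def less_2_cases_iff)
    moreover have "N \<le> 3 ^ M * a"
      using \<open>a \<ge> N\<close> mult_le_mono[of 1 "3 ^ M" N a] by simp
    ultimately show ?thesis
      by blast
  qed
  then obtain x where "x \<in> generated_subshift thue_morse32" "\<forall>i<M. x (int i) = u i"
    using generated_subshift_recurrent_word[OF finite_range_thue_morse32] by blast
  then show ?thesis
    by (intro bexI[of _ x]) (auto simp: u_def)
qed


section \<open>The triadic rationals are eigenvalues\<close>

lemma mod_int_eq_iff: "mod_int a = mod_int b \<longleftrightarrow> a - b \<in> \<int>"
  by (rule real_mod_int.abs_eq_iff)

lemma mod_int_add: "mod_int a + mod_int b = mod_int (a + b)"
  by (rule plus_real_mod_int.abs_eq)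

text \<open>The window of length \<open>L\<close> at \<open>0\<close> of a point of the subshift may occur in \<open>t\<close> at many positions \<open>p\<close>, but
  all of them agree modulo \<open>3\<^sup>n\<close>, so that \<open>kp/3\<^sup>n\<close> modulo \<open>1\<close> depends on the window only.\<close>

lemma triadic_in_eigenvalues:
  "real_of_int k / 3 ^ n \<in> additive_eigenvalues (generated_subshift thue_morse32) shift"
proof -
  let ?X = "generated_subshift thue_morse32"
  obtain L where L: "\<And>p q. (\<And>i. i < L \<Longrightarrow> thue_morse32 (p + i) = thue_morse32 (q + i)) \<Longrightarrow>
      [p = q] (mod 3 ^ n)"
    using thue_morse32_recognizable by metis
  define occ where "occ x p \<longleftrightarrow> (\<forall>i<L. x (int i) = thue_morse32 (p + i))" for x p
  define phase where "phase p = mod_int (real_of_int k * real p / 3 ^ n)" for p :: nat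
  define g where "g x = phase (SOME p. occ x p)" for x
  have phase_cong: "phase p = phase q" if "[p = q] (mod 3 ^ n)" for p q
  proof -
    have "[int p = int q] (mod 3 ^ n)"
      using that by (metis cong_int_iff of_nat_numeral of_nat_power)
    then obtain d where "int p - int q = 3 ^ n * d"
      unfolding cong_iff_dvd_diff by (elim dvdE)
    then have "real p - real q = 3 ^ n * of_int d"
      by (metis of_int_diff of_int_mult of_int_numeral of_int_of_nat_eq of_int_power)
    then have "real_of_int k * real p / 3 ^ n - real_of_int k * real q / 3 ^ n = of_int (k * d)"
      by (simp add: field_simps)
    then show ?thesis
      unfolding phase_def mod_int_eq_iff by simp
  qed
  have g_eq: "g x = phase p" if "occ x p" for x p
  proof -
    define q where "q = (SOME p. occ x p)"
    have "occ x q"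
      unfolding q_def using that by (rule someI)
    then have "[q = p] (mod 3 ^ n)"
      using that by (intro L) (metis occ_def)
    then show ?thesis
      unfolding g_def q_def by (rule phase_cong)
  qed
  have "continuous_on ?X g"
    unfolding continuous_on_open_invariant
  proof (intro allI impI)
    fix B :: "real_mod_int set"
    have "open (g -` B)"
    proof (rule open_finite_window[of "int ` {..<L}"])
      fix x y assume "x \<in> g -` B" and "\<forall>i\<in>int ` {..<L}. y i = x i"
      then have "occ y = occ x"
        by (auto simp: occ_def fun_eq_iff)
      with \<open>x \<in> g -` B\<close> show "y \<in> g -` B"
        by (simp add: g_def)
    qed simp
    then show "\<exists>A. open A \<and> A \<inter> ?X = g -` B \<inter> ?X"
      by blast
  qed
  moreover have "g (shift x) = g x + mod_int (real_of_int k / 3 ^ n)" if x: "x \<in> ?X" for x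
  proof -
    obtain p where p: "\<And>i. i < Suc L \<Longrightarrow> x (0 + int i) = thue_morse32 (p + i)"
      using x unfolding generated_subshift_def by blast
    have "occ (shift x) (p + 1)"
      using p[of "Suc i" for i] by (simp add: occ_def shift_def ac_simps)
    moreover have "occ x p"
      using p by (simp add: occ_def)
    ultimately have "g (shift x) = phase (p + 1)" "g x = phase p"
      by (simp_all add: g_eq)
    then show ?thesis
      by (simp add: phase_def mod_int_add ring_distribs add_divide_distrib add.commute)
  qed
  ultimately show ?thesis
    unfolding additive_eigenvalues_def by blast
qed


section \<open>Every eigenvalue is a triadic rational\<close>

text \<open>The embedding of \<open>\<real>/\<int>\<close> into the complex numbers supplies a metric, for uniform continuity.\<close>

lift_definition circle :: "real_mod_int \<Rightarrow> complex" is "\<lambda>r. cis (2 * pi * r)"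
proof -
  fix r s :: real assume "r - s \<in> \<int>"
  then have "cis (2 * pi * (r - s)) = 1"
    by (rule cis_multiple_2pi)
  then show "cis (2 * pi * r) = cis (2 * pi * s)"
    by (simp add: right_diff_distrib flip: cis_divide)
qed

lemma continuous_circle: "continuous_on UNIV circle"
proof -
  have "open (circle -` B)" if "open B" for B
  proof -
    have "open ((\<lambda>r. cis (2 * pi * r)) -` B)"
      using that by (intro open_vimage continuous_intros)
    also have "(\<lambda>r. cis (2 * pi * r)) -` B = mod_int -` (circle -` B)"
      by (simp add: vimage_def circle.abs_eq)
    finally show ?thesis
      by (simp add: open_real_mod_int_def)
  qed
  then show ?thesis
    by (simp add: continuous_on_open_vimage)
qed

lemma circle_add: "circle (a + b) = circle a * circle b"
  by transfer (simp add: cis_mult ring_distribs)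

lemma norm_circle: "norm (circle a) = 1"
  by transfer simp

lemma eigenfunction_funpow:
  assumes "\<And>x. x \<in> X \<Longrightarrow> S x \<in> X" "\<And>x. x \<in> X \<Longrightarrow> g (S x) = g x + mod_int \<alpha>" "x \<in> X"
  shows "g ((S ^^ h) x) = g x + mod_int (real h * \<alpha>)"
proof (induction h)
  case 0
  then show ?case by (simp add: zero_real_mod_int_def)
next
  case (Suc h)
  have "(S ^^ h) x \<in> X"
    using assms(1,3) by (induction h) simp_all
  with Suc show ?case
    by (simp add: assms(2) add.assoc mod_int_add ring_distribs add.commute)
qed

text \<open>Uniform continuity on a compact set of words, in terms of windows instead of a
  metric on words: finitely many cylinders, on each of which \<open>f\<close> varies by less than \<open>\<epsilon>\<close>, cover \<open>X\<close>.\<close>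

lemma uniform_window:
  fixes f :: "('i \<Rightarrow> 'a::discrete_topology) \<Rightarrow> 'b::metric_space"
  assumes "compact X" "continuous_on X f" "\<epsilon> > 0"
  shows "\<exists>F. finite F \<and> (\<forall>x\<in>X. \<forall>y\<in>X. (\<forall>i\<in>F. x i = y i) \<longrightarrow> dist (f x) (f y) < \<epsilon>)"
proof -
  have "\<exists>F. finite F \<and> (\<forall>y\<in>X. (\<forall>i\<in>F. y i = x i) \<longrightarrow> dist (f x) (f y) < \<epsilon> / 2)" if "x \<in> X" for x
  proof -
    obtain A where "open A" and A: "A \<inter> X = f -` ball (f x) (\<epsilon> / 2) \<inter> X"
      using assms(2) unfolding continuous_on_open_invariant by (metis open_ball)
    have "x \<in> A"
      using that A assms(3) by auto
    then obtain B where x_in: "x \<in> (\<Pi>\<^sub>E i\<in>UNIV. B i)" and fin: "finite {i. B i \<noteq> UNIV}"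
      and sub: "(\<Pi>\<^sub>E i\<in>UNIV. B i) \<subseteq> A"
      using product_topology_open_contains_basis[of "\<lambda>_. euclidean" UNIV A x] \<open>open A\<close>
      by (auto simp: open_fun_def)
    have "dist (f x) (f y) < \<epsilon> / 2" if y: "y \<in> X" "\<forall>i\<in>{i. B i \<noteq> UNIV}. y i = x i" for y
    proof -
      have "y \<in> (\<Pi>\<^sub>E i\<in>UNIV. B i)"
        using x_in y(2) by (fastforce simp: PiE_UNIV_domain)
      with sub y(1) have "y \<in> f -` ball (f x) (\<epsilon> / 2)"
        using A by blast
      then show ?thesis
        by simp
    qed
    with fin show ?thesis
      by blast
  qed
  then obtain F where fin: "\<And>x. x \<in> X \<Longrightarrow> finite (F x)"
    and F: "\<And>x y. x \<in> X \<Longrightarrow> y \<in> X \<Longrightarrow> \<forall>i\<in>F x. y i = x i \<Longrightarrow> dist (f x) (f y) < \<epsilon> / 2"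
    by metis
  define C where "C x = {y. \<forall>i\<in>F x. y i = x i}" for x
  have "open (C x)" if "x \<in> X" for x
    by (rule open_finite_window[OF fin[OF that]]) (simp add: C_def)
  moreover have "X \<subseteq> (\<Union>x\<in>X. C x)"
    by (auto simp: C_def)
  ultimately obtain D where D: "D \<subseteq> X" "finite D" "X \<subseteq> (\<Union>x\<in>D. C x)"
    by (rule compactE_image[OF assms(1)])
  have "dist (f y) (f z) < \<epsilon>" if "y \<in> X" "z \<in> X" "\<forall>i\<in>(\<Union>x\<in>D. F x). y i = z i" for y z
  proof -
    obtain x where "x \<in> D" and y: "\<forall>i\<in>F x. y i = x i"
      using D(3) \<open>y \<in> X\<close> unfolding C_def by blast
    then have z: "\<forall>i\<in>F x. z i = x i"
      using that(3) by (metis UN_I)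
    have "x \<in> X"
      using D(1) \<open>x \<in> D\<close> by blast
    then have "dist (f x) (f y) < \<epsilon> / 2" "dist (f x) (f z) < \<epsilon> / 2"
      using F that(1,2) y z by blast+
    then show ?thesis
      by (rule dist_triangle_half_r)
  qed
  moreover have "finite (\<Union>x\<in>D. F x)"
    using D(1,2) fin by auto
  ultimately show ?thesis
    by blast
qed

text \<open>In a point of \<open>X\<close> with the equality pattern of \<open>t\<close>, the shifts by \<open>2 \<cdot> 3\<^sup>n\<close> and
  \<open>3 \<cdot> 3\<^sup>n\<close> agree on a long window, so the eigenfunction, which differs by \<open>3\<^sup>n\<alpha>\<close> between them,
  takes nearby values there.\<close>

lemma eigenvalue_powers_tendsto:
  assumes "\<alpha> \<in> additive_eigenvalues (generated_subshift thue_morse32) shift"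
  shows "(\<lambda>n. circle (mod_int (3 ^ n * \<alpha>))) \<longlonglongrightarrow> 1"
proof (rule metric_LIMSEQ_I)
  fix \<epsilon> :: real assume "\<epsilon> > 0"
  let ?X = "generated_subshift thue_morse32"
  obtain g where g: "continuous_on ?X g" "\<And>x. x \<in> ?X \<Longrightarrow> g (shift x) = g x + mod_int \<alpha>"
    using assms unfolding additive_eigenvalues_def by blast
  have "continuous_on ?X (circle \<circ> g)"
    using g(1) continuous_circle by (intro continuous_on_compose) (auto intro: continuous_on_subset)
  with compact_generated_subshift[OF finite_range_thue_morse32]
  obtain F where "finite F" and F: "\<And>x y. x \<in> ?X \<Longrightarrow> y \<in> ?X \<Longrightarrow> (\<And>i. i \<in> F \<Longrightarrow> x i = y i) \<Longrightarrow>
      dist (circle (g x)) (circle (g y)) < \<epsilon>"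
    using uniform_window[of ?X "circle \<circ> g" \<epsilon>] \<open>\<epsilon> > 0\<close> by (metis comp_apply)
  obtain c where c: "\<And>i. i \<in> F \<Longrightarrow> \<bar>i\<bar> \<le> int c"
  proof
    fix i assume "i \<in> F"
    with \<open>finite F\<close> have "nat \<bar>i\<bar> \<le> (\<Sum>i\<in>F. nat \<bar>i\<bar>)"
      by (intro member_le_sum) simp_all
    then show "\<bar>i\<bar> \<le> int (\<Sum>i\<in>F. nat \<bar>i\<bar>)"
      by linarith
  qed
  have "dist (circle (mod_int (3 ^ n * \<alpha>))) 1 < \<epsilon>" if "2 * c \<le> n" for n
  proof -
    obtain x where x: "x \<in> ?X" and pattern: "\<And>i j. i < 4 * 3 ^ n + n \<Longrightarrow> j < 4 * 3 ^ n + n \<Longrightarrow>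
        thue_morse32 i = thue_morse32 j \<Longrightarrow> x (int i) = x (int j)"
      using subshift_contains_equality_pattern[of "4 * 3 ^ n + n"] by metis
    \<comment> \<open>The additional shift by \<open>c\<close> centres the one-sided common window \<open>{0..n}\<close> around \<open>F\<close>.\<close>
    define y where "y = (shift ^^ (2 * 3 ^ n + c)) x"
    define z where "z = (shift ^^ (3 ^ n)) y"
    have X: "y \<in> ?X" "z \<in> ?X"
      using x by (simp_all add: y_def z_def funpow_shift_generated_subshift)
    have "z i = y i" if "i \<in> F" for i
    proof -
      define j where "j = nat (i + int c)"
      have i: "i + int c = int j" and "j \<le> n"
        using c[OF that] \<open>2 * c \<le> n\<close> by (simp_all add: j_def)
      have "y i = x (int (2 * 3 ^ n + j))" "z i = x (int (3 * 3 ^ n + j))"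
        unfolding y_def z_def funpow_shift of_nat_add i[symmetric] by (simp_all add: ac_simps)
      moreover have "x (int (2 * 3 ^ n + j)) = x (int (3 * 3 ^ n + j))"
        using \<open>j \<le> n\<close> by (intro pattern thue_morse32_return) (simp_all add: add_less_le_mono)
      ultimately show ?thesis
        by simp
    qed
    with X have "dist (circle (g z)) (circle (g y)) < \<epsilon>"
      by (intro F)
    moreover have "g z = g y + mod_int (3 ^ n * \<alpha>)"
      using eigenfunction_funpow[of ?X shift g \<alpha> y "3 ^ n"] X g(2)
      by (simp add: z_def shift_generated_subshift)
    then have "circle (g z) - circle (g y) = circle (g y) * (circle (mod_int (3 ^ n * \<alpha>)) - 1)"
      by (simp add: circle_add algebra_simps)
    then have "dist (circle (g z)) (circle (g y)) = dist (circle (mod_int (3 ^ n * \<alpha>))) 1"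
      by (simp add: dist_norm norm_mult norm_circle)
    ultimately show ?thesis
      by simp
  qed
  then show "\<exists>N. \<forall>n\<ge>N. dist (circle (mod_int (3 ^ n * \<alpha>))) 1 < \<epsilon>"
    by blast
qed

text \<open>Near \<open>1\<close> the cube map at least doubles the distance to \<open>1\<close>, since
  \<open>(1 + \<delta>)\<^sup>3 - 1 = \<delta> (3 + 3\<delta> + \<delta>\<^sup>2)\<close>; an orbit that converges to \<open>1\<close> must therefore hit it.\<close>

lemma cubing_repels_from_1:
  fixes z :: "nat \<Rightarrow> 'a::real_normed_field"
  assumes "z \<longlonglongrightarrow> 1" and cube: "\<And>n. z (Suc n) = z n ^ 3"
  shows "\<exists>n. z n = 1"
proof -
  \<comment> \<open>If \<open>|\<delta>| < 1/4\<close>, then \<open>|3 + 3\<delta> + \<delta>\<^sup>2| > 3 - 3/4 - 1/16 > 2\<close>.\<close>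
  obtain N where N: "\<And>n. n \<ge> N \<Longrightarrow> norm (z n - 1) < 1/4"
    using LIMSEQ_D[OF assms(1), of "1/4"] by auto
  have growth: "2 ^ k * norm (z N - 1) \<le> norm (z (N + k) - 1)" for k
  proof (induction k)
    case (Suc k)
    define \<delta> where "\<delta> = z (N + k) - 1"
    have \<delta>: "norm \<delta> < 1/4"
      using N[of "N + k"] by (simp add: \<delta>_def)
    have "z (N + Suc k) - 1 = (1 + \<delta>) ^ 3 - 1"
      by (simp add: cube \<delta>_def)
    also have "\<dots> = \<delta> * (3 - (- 3 * \<delta> - \<delta>\<^sup>2))"
      by (simp add: power3_eq_cube power2_eq_square algebra_simps)
    finally have eq: "norm (z (N + Suc k) - 1) = norm \<delta> * norm (3 - (- 3 * \<delta> - \<delta>\<^sup>2))"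
      by (simp only: norm_mult)
    have "norm (- 3 * \<delta> - \<delta>\<^sup>2) \<le> 3 * norm \<delta> + (norm \<delta>)\<^sup>2"
      using norm_triangle_ineq4[of "- 3 * \<delta>" "\<delta>\<^sup>2"] by (simp add: norm_mult norm_power)
    moreover have "(norm \<delta>)\<^sup>2 \<le> (1/4)\<^sup>2"
      using \<delta> by (intro power_mono) auto
    ultimately have "2 \<le> norm (3 - (- 3 * \<delta> - \<delta>\<^sup>2))"
      using norm_triangle_ineq2[of 3 "- 3 * \<delta> - \<delta>\<^sup>2"] \<delta> norm_ge_zero[of \<delta>]
      by (simp add: power2_eq_square)
    then have "norm \<delta> * 2 \<le> norm (z (N + Suc k) - 1)"
      unfolding eq by (intro mult_left_mono) simp_all
    with Suc show ?case
      by (simp add: \<delta>_def)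
  qed simp
  show ?thesis
  proof (rule ccontr)
    assume "\<not> ?thesis"
    then have pos: "norm (z N - 1) > 0"
      by simp
    obtain k where "1 / norm (z N - 1) < 2 ^ k"
      using real_arch_pow[of 2] by auto
    then have "1 < 2 ^ k * norm (z N - 1)"
      using pos by (simp add: field_simps)
    with growth[of k] N[of "N + k"] show False
      by simp
  qed
qed

theorem theorem8p6:
  "additive_eigenvalues (generated_subshift thue_morse32) shift =
     {real_of_int k / 3 ^ n | (k :: int) (n :: nat). True}"
proof (intro subset_antisym subsetI)
  fix \<alpha> assume "\<alpha> \<in> additive_eigenvalues (generated_subshift thue_morse32) shift"
  then have "(\<lambda>n. circle (mod_int (3 ^ n * \<alpha>))) \<longlonglongrightarrow> 1"
    by (rule eigenvalue_powers_tendsto)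
  moreover have "circle (mod_int (3 ^ Suc n * \<alpha>)) = circle (mod_int (3 ^ n * \<alpha>)) ^ 3" for n
    unfolding circle.abs_eq Complex.DeMoivre by (simp add: ac_simps)
  ultimately obtain n where "circle (mod_int (3 ^ n * \<alpha>)) = 1"
    using cubing_repels_from_1 by blast
  then have "cos (2 * pi * (3 ^ n * \<alpha>)) = 1"
    by (simp add: circle.abs_eq complex_eq_iff)
  then obtain k :: int where "2 * pi * (3 ^ n * \<alpha>) = of_int k * 2 * pi"
    using cos_one_2pi_int by blast
  then have "\<alpha> = of_int k / 3 ^ n"
    by (simp add: field_simps)
  then show "\<alpha> \<in> {real_of_int k / 3 ^ n | (k :: int) (n :: nat). True}"
    by blast
next
  fix \<alpha> assume "\<alpha> \<in> {real_of_int k / 3 ^ n | (k :: int) (n :: nat). True}"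
  then show "\<alpha> \<in> additive_eigenvalues (generated_subshift thue_morse32) shift"
    using triadic_in_eigenvalues by auto
qed

end
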